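(* Let $n_1,n_2\ge 1$ be integers. The number $a(K_{n_1,n_2})$ of acyclic orientations of the complete bipartite graph $K_{n_1,n_2}$ satisfies $$a(K_{n_1,n_2})=B_{n_1}^{(-n_2)}=B_{n_2}^{(-n_1)},$$ where $B_n^{(k)}$ denotes the poly-Bernoulli numbers.
   Context: An acyclic orientation of a graph $G$ is an assignment of a direction to each edge of $G$ such that the resulting directed graph has no directed cycles; $a(G)$ denotes the number of acyclic orientations of $G$. $K_{n_1,n_2}$ is the complete bipartite graph with parts of sizes $n_1$ and $n_2$. For an integer $k$ let $\mathrm{Li}_k(z)=\sum_{i=1}^\infty \frac{z^i}{i^k}$. The poly-Bernoulli numbers $B_n^{(k)}$ of order $k$ (for $n\ge 0$) are defined by the generating function $$\frac{\mathrm{Li}_k(1-\mathrm{e}^{-x})}{1-\mathrm{e}^{-x}}=\sum_{n=0}^\infty B_n^{(k)}\frac{x^n}{n!}.$$ *)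

theory Defs
  imports "HOL-Computational_Algebra.Formal_Power_Series"
begin

record 'a ugraph =
  verts :: "'a set"
  edges :: "'a set set"

text \<open>
  An orientation is given by its set of arcs \<open>(u, v)\<close>; bijectivity says that every arc is
  a directed edge of the graph and that every edge receives exactly one of its directions.
\<close>

definition orientation :: "'a ugraph \<Rightarrow> ('a \<times> 'a) set \<Rightarrow> bool" where
  "orientation G D \<longleftrightarrow> bij_betw (\<lambda>(u, v). {u, v}) D (edges G)"

definition acyclic_orientations :: "'a ugraph \<Rightarrow> ('a \<times> 'a) set set" where
  "acyclic_orientations G = {D. orientation G D \<and> acyclic D}"

definition num_acyclic_orientations :: "'a ugraph \<Rightarrow> nat" where
  "num_acyclic_orientations G = card (acyclic_orientations G)"

definition complete_bipartite :: "nat \<Rightarrow> nat \<Rightarrow> (nat + nat) ugraph" where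
  "complete_bipartite m n =
     \<lparr>verts = Inl ` {..<m} \<union> Inr ` {..<n},
      edges = {{Inl i, Inr j} | i j. i < m \<and> j < n}\<rparr>"

definition polylog_fps :: "int \<Rightarrow> rat fps" where
  "polylog_fps k = Abs_fps (\<lambda>i. if i = 0 then 0 else 1 / (of_nat i powi k))"

text \<open>
  The series \<open>1 - e\<^sup>-\<^sup>x\<close> has constant term 0, so the formal composition is meaningful; it has
  order 1 and the numerator has order at least 1, so the quotient is exact
  (\<open>poly_bernoulli_gf_exact\<close>).
\<close>

definition poly_bernoulli_gf :: "int \<Rightarrow> rat fps" where
  "poly_bernoulli_gf k =
     (polylog_fps k oo (1 - fps_exp (- 1))) / (1 - fps_exp (- 1))"

text \<open>\<open>poly_bernoulli k n\<close> is the number $B_n^{(k)}$ (order first, index second).\<close>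

definition poly_bernoulli :: "int \<Rightarrow> nat \<Rightarrow> rat" where
  "poly_bernoulli k n = fact n * fps_nth (poly_bernoulli_gf k) n"

lemma poly_bernoulli_gf_exact:
  "poly_bernoulli_gf k * (1 - fps_exp (- 1)) = polylog_fps k oo (1 - fps_exp (- 1))"
proof -
  let ?g = "1 - fps_exp (- 1) :: rat fps"
  let ?f = "polylog_fps k oo ?g"
  have g1: "fps_nth ?g 1 \<noteq> 0" by simp
  have g0: "?g \<noteq> 0" using g1 by (metis fps_zero_nth)
  have sg: "subdegree ?g \<le> 1" using g1 by (rule subdegree_leI)
  have f0: "fps_nth ?f 0 = 0" by (simp add: polylog_fps_def)
  have "?g dvd ?f"
  proof (cases "?f = 0")
    case False
    then have "subdegree ?f \<noteq> 0" using f0 False by (metis subdegree_eq_0_iff)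
    then show ?thesis using sg g0 False by (simp add: fps_dvd_iff)
  qed simp
  then show ?thesis by (simp add: poly_bernoulli_gf_def)
qed

end

theory Submission
  imports Defs
begin

text \<open>
  An orientation of \<open>K\<^bsub>m,n\<^esub>\<close> is the same thing as a relation \<open>R\<close> between the two parts: \<open>R\<close>
  holds at \<open>(i, j)\<close> when the edge between \<open>i\<close> and \<open>j\<close> points from left to right. Two left
  vertices with incomparable out-neighbourhoods lie on a directed 4-cycle; conversely, if the
  out-neighbourhoods form a chain, then a height function read off from that chain strictly
  decreases along every arc. So the acyclic orientations correspond to the relations whose rows form
  a chain under inclusion (\<open>num_acyclic_orientations_complete_bipartite\<close>); read as 0-1 matrices
  these are the lonesum matrices. The condition does not change under transposition, which gives
  the symmetry of the poly-Bernoulli numbers.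

  Lonesum relations and poly-Bernoulli numbers satisfy the same recursion
  \[ B_n^{(-k-1)} = B_n^{(-k)} + \sum_{m=1}^{n} {n \choose m} B_{n-m+1}^{(-k)}, \qquad B_n^{(0)} = 1. \]
  On the combinatorial side (\<open>card_lonesum_relations_insert\<close>) a new column \<open>r\<close> is added. If it is
  not empty, let \<open>T\<close> be the set of those rows that are smallest among the rows containing \<open>r\<close>. All
  rows in \<open>T\<close> are equal, so they can be merged into one; deleting \<open>r\<close> then loses nothing, because
  outside \<open>T\<close> the rows containing \<open>r\<close> are those strictly larger than the merged row. On the
  analytic side (\<open>poly_bernoulli_gf_Suc\<close>) the recursion is the differential equation
  \<open>G\<^bsub>k+1\<^esub> = G\<^bsub>k\<^esub> + (e\<^sup>x - 1) G\<^bsub>k\<^esub>'\<close> for the generating functions, which comes from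
  \<open>Li\<^bsub>-k-1\<^esub>(z) = z Li\<^bsub>-k\<^esub>'(z)\<close>.
\<close>

section \<open>The recursion for poly-Bernoulli numbers of nonpositive order\<close>

lemma polylog_fps_neg_nth:
  "fps_nth (polylog_fps (- int k)) i = (if i = 0 then 0 else of_nat i ^ k)"
  by (simp add: polylog_fps_def power_int_minus divide_inverse)

lemma polylog_fps_neg_Suc:
  "polylog_fps (- int (Suc k)) = fps_X * fps_deriv (polylog_fps (- int k))"
proof (rule fps_ext)
  fix i
  show "fps_nth (polylog_fps (- int (Suc k))) i
      = fps_nth (fps_X * fps_deriv (polylog_fps (- int k))) i"
    unfolding polylog_fps_neg_nth fps_X_mult_nth fps_deriv_nth by (cases i) auto
qed

lemma polylog_fps_0: "polylog_fps 0 * (1 - fps_X) = fps_X"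
proof (rule fps_ext)
  fix i
  show "fps_nth (polylog_fps 0 * (1 - fps_X)) i = fps_nth fps_X i"
    using polylog_fps_neg_nth[of 0] by (cases i) (auto simp: right_diff_distrib fps_X_nth)
qed

lemma one_minus_fps_exp_neq_0: "1 - fps_exp (- 1) \<noteq> (0 :: rat fps)"
proof
  assume "1 - fps_exp (- 1) = (0 :: rat fps)"
  then have "fps_nth (1 - fps_exp (- 1) :: rat fps) 1 = 0" by simp
  then show False by simp
qed

lemma fps_exp_mult_minus: "fps_exp (1 :: rat) * fps_exp (- 1) = 1"
  by (simp add: fps_exp_add_mult[symmetric])

lemma poly_bernoulli_gf_0: "poly_bernoulli_gf 0 = fps_exp 1"
proof -
  let ?u = "1 - fps_exp (- 1) :: rat fps"
  have "(polylog_fps 0 * (1 - fps_X)) oo ?u = fps_X oo ?u"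
    by (simp only: polylog_fps_0)
  then have "(polylog_fps 0 oo ?u) * (1 - ?u) = ?u"
    by (simp add: fps_compose_mult_distrib fps_compose_sub_distrib)
  then have "?u * (poly_bernoulli_gf 0 * fps_exp (- 1)) = ?u * 1"
    by (simp add: poly_bernoulli_gf_exact[symmetric] mult_ac)
  then have "poly_bernoulli_gf 0 * fps_exp (- 1) = 1"
    using mult_left_cancel[OF one_minus_fps_exp_neq_0] by blast
  then show ?thesis
    by (metis fps_exp_mult_minus mult.assoc mult.commute mult_1)
qed

text \<open>
  With \<open>u = 1 - e\<^sup>-\<^sup>x\<close> and \<open>G\<^sub>k u = Li\<^bsub>-k\<^esub>(u)\<close>, the identity \<open>Li\<^bsub>-k-1\<^esub>(z) = z Li\<^bsub>-k\<^esub>'(z)\<close> says that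
  \<open>G\<^bsub>k+1\<^esub> = Li\<^bsub>-k\<^esub>'(u)\<close>. The chain rule turns this into \<open>(G\<^sub>k u)' = G\<^bsub>k+1\<^esub> e\<^sup>-\<^sup>x\<close>.
\<close>

lemma poly_bernoulli_gf_Suc:
  "poly_bernoulli_gf (- int (Suc k))
     = poly_bernoulli_gf (- int k) + (fps_exp 1 - 1) * fps_deriv (poly_bernoulli_gf (- int k))"
proof -
  let ?u = "1 - fps_exp (- 1) :: rat fps"
  let ?P = "polylog_fps (- int k)"
  let ?G = "poly_bernoulli_gf (- int k)" and ?H = "poly_bernoulli_gf (- int (Suc k))"
  have "?H * ?u = (fps_X * fps_deriv ?P) oo ?u"
    by (simp only: poly_bernoulli_gf_exact polylog_fps_neg_Suc)
  also have "\<dots> = (fps_deriv ?P oo ?u) * ?u"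
    by (simp add: fps_compose_mult_distrib mult.commute)
  finally have H: "?H = fps_deriv ?P oo ?u"
    using mult_right_cancel[OF one_minus_fps_exp_neq_0] by blast
  have u0: "fps_nth ?u 0 = 0" by simp
  have du: "fps_deriv ?u = fps_exp (- 1)" by (simp add: fps_eq_iff)
  have "fps_deriv (?G * ?u) = fps_deriv (?P oo ?u)"
    by (simp only: poly_bernoulli_gf_exact)
  also have "\<dots> = ?H * fps_exp (- 1)"
    by (simp only: fps_compose_deriv[OF u0] H du)
  finally have "?H * fps_exp (- 1) = ?G * fps_exp (- 1) + fps_deriv ?G * ?u"
    by (simp only: fps_deriv_mult du add.commute)
  then have "fps_exp 1 * (?H * fps_exp (- 1))
      = fps_exp 1 * (?G * fps_exp (- 1) + fps_deriv ?G * ?u)"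
    by simp
  then have "?H * (fps_exp 1 * fps_exp (- 1))
      = ?G * (fps_exp 1 * fps_exp (- 1))
        + fps_deriv ?G * (fps_exp 1 - fps_exp 1 * fps_exp (- 1))"
    by (simp only: algebra_simps mult_1)
  then show ?thesis
    by (simp add: fps_exp_mult_minus mult.commute)
qed

lemma poly_bernoulli_0: "poly_bernoulli 0 n = 1"
  by (simp add: poly_bernoulli_def poly_bernoulli_gf_0)

lemma poly_bernoulli_Suc:
  "poly_bernoulli (- int (Suc k)) n
     = poly_bernoulli (- int k) n
       + (\<Sum>i = 1..n. of_nat (n choose i) * poly_bernoulli (- int k) (Suc (n - i)))"
proof -
  let ?G = "poly_bernoulli_gf (- int k)"
  have "fact n * fps_nth ((fps_exp 1 - 1) * fps_deriv ?G) n
      = (\<Sum>i = 0..n. fact n * (fps_nth (fps_exp 1 - 1) i * fps_nth (fps_deriv ?G) (n - i)))"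
    by (simp add: fps_mult_nth sum_distrib_left)
  also have "\<dots> = (\<Sum>i = 1..n. fact n * (fps_nth (fps_exp 1 - 1) i * fps_nth (fps_deriv ?G) (n - i)))"
    by (rule sum.mono_neutral_right) (auto simp: not_le)
  also have "\<dots> = (\<Sum>i = 1..n. of_nat (n choose i) * poly_bernoulli (- int k) (Suc (n - i)))"
  proof (rule sum.cong)
    fix i assume "i \<in> {1..n}"
    then have "fps_nth (fps_exp 1 - 1 :: rat fps) i = 1 / fact i"
      and "(of_nat (n choose i) :: rat) = fact n / (fact i * fact (n - i))"
      by (simp_all add: binomial_fact)
    then show "fact n * (fps_nth (fps_exp 1 - 1) i * fps_nth (fps_deriv ?G) (n - i))
        = of_nat (n choose i) * poly_bernoulli (- int k) (Suc (n - i))"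
      unfolding fps_deriv_nth poly_bernoulli_def by (simp add: divide_simps mult_ac)
  qed simp
  finally show ?thesis
    unfolding poly_bernoulli_def poly_bernoulli_gf_Suc fps_add_nth by (simp only: distrib_left)
qed

section \<open>Lonesum relations\<close>

definition lonesum :: "('a \<times> 'b) set \<Rightarrow> bool" where
  "lonesum R \<longleftrightarrow> (\<forall>x y. R `` {x} \<subseteq> R `` {y} \<or> R `` {y} \<subseteq> R `` {x})"

definition lonesum_relations :: "'a set \<Rightarrow> 'b set \<Rightarrow> ('a \<times> 'b) set set" where
  "lonesum_relations A B = {R. R \<subseteq> A \<times> B \<and> lonesum R}"

lemma finite_lonesum_relations:
  "finite A \<Longrightarrow> finite B \<Longrightarrow> finite (lonesum_relations A B)"
  unfolding lonesum_relations_def by (rule finite_subset[of _ "Pow (A \<times> B)"]) auto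

text \<open>
  This form, which says that no 2-by-2 submatrix is a permutation matrix, treats rows and columns
  alike.
\<close>

lemma lonesum_iff_no_permutation:
  "lonesum R \<longleftrightarrow>
     (\<forall>x y a b. (x, a) \<in> R \<longrightarrow> (y, b) \<in> R \<longrightarrow> (x, b) \<in> R \<or> (y, a) \<in> R)"
  unfolding lonesum_def by blast

lemma lonesum_converse: "lonesum (R\<inverse>) \<longleftrightarrow> lonesum R"
  unfolding lonesum_iff_no_permutation by blast

lemma lonesum_Int_Times: "lonesum R \<Longrightarrow> lonesum (R \<inter> A \<times> B)"
  unfolding lonesum_iff_no_permutation by blast

lemma card_lonesum_relations_commute:
  "card (lonesum_relations A B) = card (lonesum_relations B A)"
proof (rule bij_betw_same_card)
  show "bij_betw converse (lonesum_relations A B) (lonesum_relations B A)"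
    by (rule bij_betw_byWitness[where f' = converse])
      (auto simp: lonesum_relations_def lonesum_converse)
qed

section \<open>Adding a column to a lonesum relation\<close>

text \<open>
  The set \<open>T\<close> of the recursion. The rows of its elements contain each other, so they are all equal,
  even though \<open>T\<close> itself may have several elements.
\<close>

definition minimal_rows :: "'b \<Rightarrow> ('a \<times> 'b) set \<Rightarrow> 'a set" where
  "minimal_rows r R = {x. (x, r) \<in> R \<and> (\<forall>y. (y, r) \<in> R \<longrightarrow> R `` {x} \<subseteq> R `` {y})}"

text \<open>
  The inverse of merging the rows in \<open>T\<close> into the single row \<open>t\<close> and deleting the column \<open>r\<close>.
  A row outside \<open>T\<close> that equals row \<open>t\<close> must not receive \<open>r\<close>, since otherwise it would belong to
  \<open>T\<close>; hence the strict inclusion.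
\<close>

definition add_column :: "'b \<Rightarrow> 'a set \<Rightarrow> 'a \<Rightarrow> ('a \<times> 'b) set \<Rightarrow> ('a \<times> 'b) set" where
  "add_column r T t S =
     {(x, b) \<in> S. x \<notin> T} \<union> T \<times> insert r (S `` {t}) \<union> {x. x \<notin> T \<and> S `` {t} \<subset> S `` {x}} \<times> {r}"

lemma add_column_row_in: "x \<in> T \<Longrightarrow> add_column r T t S `` {x} = insert r (S `` {t})"
  unfolding add_column_def by auto

lemma add_column_row_notin:
  "x \<notin> T \<Longrightarrow> add_column r T t S `` {x}
     = (if S `` {t} \<subset> S `` {x} then insert r (S `` {x}) else S `` {x})"
  unfolding add_column_def by auto

lemma relation_eqI: "(\<And>x. R `` {x} = S `` {x}) \<Longrightarrow> R = S"
  by (auto simp: set_eq_iff)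

text \<open>Among the rows containing \<open>r\<close>, one of least cardinality is contained in all the others,
  because the rows form a chain of finite sets.\<close>

lemma minimal_rows_eq_empty_iff:
  assumes "finite B" and R: "R \<subseteq> A \<times> B" "lonesum R"
  shows "minimal_rows r R = {} \<longleftrightarrow> r \<notin> Range R"
proof
  show "minimal_rows r R = {}" if "r \<notin> Range R"
    using that unfolding minimal_rows_def by blast
next
  assume empty: "minimal_rows r R = {}"
  show "r \<notin> Range R"
  proof
    assume "r \<in> Range R"
    then obtain x where "(x, r) \<in> R" by blast
    then obtain x where x: "(x, r) \<in> R"
      and least: "\<And>y. (y, r) \<in> R \<Longrightarrow> card (R `` {x}) \<le> card (R `` {y})"
      using ex_has_least_nat[of "\<lambda>x. (x, r) \<in> R" x "\<lambda>x. card (R `` {x})"] by blast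
    have fin: "finite (R `` {y})" for y
      by (rule finite_subset[OF _ \<open>finite B\<close>]) (use R in blast)
    have "R `` {x} \<subseteq> R `` {y}" if "(y, r) \<in> R" for y
      using R(2) least[OF that] card_seteq[OF fin, of "R `` {y}" x] unfolding lonesum_def by blast
    then have "x \<in> minimal_rows r R" using x unfolding minimal_rows_def by blast
    then show False using empty by blast
  qed
qed

lemma lonesum_add_column:
  assumes "lonesum S"
  shows "lonesum (add_column r T t S)"
  unfolding lonesum_def
proof (intro allI)
  fix x y
  have rows: "(if x \<in> T then insert r C else if C \<subset> A then insert r A else A)
        \<subseteq> (if y \<in> T then insert r C else if C \<subset> B then insert r B else B)
      \<or> (if y \<in> T then insert r C else if C \<subset> B then insert r B else B)
        \<subseteq> (if x \<in> T then insert r C else if C \<subset> A then insert r A else A)"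
    if "A \<subseteq> B \<or> B \<subseteq> A" "A \<subseteq> C \<or> C \<subseteq> A" "B \<subseteq> C \<or> C \<subseteq> B" for A B C
    using that by (simp split: if_split) blast
  have row: "add_column r T t S `` {z}
      = (if z \<in> T then insert r (S `` {t})
         else if S `` {t} \<subset> S `` {z} then insert r (S `` {z}) else S `` {z})" for z
    by (simp add: add_column_row_in add_column_row_notin)
  show "add_column r T t S `` {x} \<subseteq> add_column r T t S `` {y}
      \<or> add_column r T t S `` {y} \<subseteq> add_column r T t S `` {x}"
    unfolding row by (rule rows) (use assms in \<open>simp_all add: lonesum_def\<close>)
qed

lemma minimal_rows_add_column:
  assumes "r \<notin> Range S" and "t \<in> T"
  shows "minimal_rows r (add_column r T t S) = T"
proof -
  let ?R = "add_column r T t S"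
  have r: "(x, r) \<in> ?R \<longleftrightarrow> x \<in> T \<or> S `` {t} \<subset> S `` {x}" for x
    using assms unfolding add_column_def by auto
  have "x \<in> minimal_rows r ?R" if "x \<in> T" for x
  proof -
    have "insert r (S `` {t}) \<subseteq> ?R `` {y}" if "y \<in> T \<or> S `` {t} \<subset> S `` {y}" for y
      using that by (cases "y \<in> T") (auto simp: add_column_row_in add_column_row_notin)
    then show ?thesis
      using that unfolding minimal_rows_def r by (simp add: add_column_row_in)
  qed
  moreover have "x \<notin> minimal_rows r ?R" if "x \<notin> T" for x
  proof
    assume "x \<in> minimal_rows r ?R"
    then have "S `` {t} \<subset> S `` {x}" and "?R `` {x} \<subseteq> ?R `` {t}"
      using that assms(2) by (simp_all add: minimal_rows_def r)
    then have "S `` {t} \<subset> S `` {x}" and "insert r (S `` {x}) \<subseteq> insert r (S `` {t})"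
      using that assms(2) by (simp_all add: add_column_row_in add_column_row_notin)
    moreover have "r \<notin> S `` {x}" using assms(1) by blast
    ultimately show False by (metis insert_subset psubsetE subset_insert)
  qed
  ultimately show ?thesis by blast
qed

lemma add_column_restrict:
  assumes R: "R \<subseteq> X \<times> insert r K" "lonesum R" and r: "r \<notin> K"
    and T: "minimal_rows r R = T" and t: "t \<in> T"
  shows "add_column r T t (R \<inter> insert t (X - T) \<times> K) = R"
proof (rule relation_eqI)
  fix x
  let ?S = "R \<inter> insert t (X - T) \<times> K"
  have S: "?S `` {y} = R `` {y} - {r}" if "y = t \<or> y \<notin> T" for y
    using that R r by blast
  have rt: "(t, r) \<in> R" using T t unfolding minimal_rows_def by blast
  show "add_column r T t ?S `` {x} = R `` {x}"
  proof (cases "x \<in> T")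
    case True
    then have "R `` {x} = R `` {t}" using T t unfolding minimal_rows_def by blast
    then show ?thesis using True rt S[of t] by (auto simp: add_column_row_in)
  next
    case False
    have "(x, r) \<in> R \<longleftrightarrow> R `` {t} - {r} \<subset> R `` {x} - {r}"
    proof
      assume xr: "(x, r) \<in> R"
      have "R `` {t} \<subseteq> R `` {x}" using T t xr unfolding minimal_rows_def by blast
      moreover have "R `` {t} \<noteq> R `` {x}"
        using False T t xr unfolding minimal_rows_def by blast
      ultimately show "R `` {t} - {r} \<subset> R `` {x} - {r}" using xr rt by blast
    next
      assume "R `` {t} - {r} \<subset> R `` {x} - {r}"
      moreover have "R `` {t} \<subseteq> R `` {x} \<or> R `` {x} \<subseteq> R `` {t}"
        using R(2) unfolding lonesum_def by blast
      ultimately show "(x, r) \<in> R" using rt by blast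
    qed
    then show ?thesis
      using False S[of x] S[of t] by (auto simp: add_column_row_notin)
  qed
qed

lemma restrict_add_column:
  assumes S: "S \<subseteq> insert t (X - T) \<times> K" and r: "r \<notin> K" and t: "t \<in> T"
  shows "add_column r T t S \<inter> insert t (X - T) \<times> K = S"
  using assms unfolding add_column_def by auto

lemma card_lonesum_relations_minimal_rows:
  assumes r: "r \<notin> K" and T: "T \<subseteq> X" and t: "t \<in> T"
  shows "card {R \<in> lonesum_relations X (insert r K). minimal_rows r R = T}
       = card (lonesum_relations (insert t (X - T)) K)"
proof (rule bij_betw_same_card)
  let ?C = "{R \<in> lonesum_relations X (insert r K). minimal_rows r R = T}"
  let ?L = "lonesum_relations (insert t (X - T)) K"
  show "bij_betw (\<lambda>R. R \<inter> insert t (X - T) \<times> K) ?C ?L"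
  proof (rule bij_betw_byWitness[where f' = "add_column r T t"])
    show "\<forall>R \<in> ?C. add_column r T t (R \<inter> insert t (X - T) \<times> K) = R"
      using add_column_restrict[OF _ _ r _ t] by (simp add: lonesum_relations_def)
    show "\<forall>S \<in> ?L. add_column r T t S \<inter> insert t (X - T) \<times> K = S"
      using restrict_add_column[OF _ r t] by (simp add: lonesum_relations_def)
    show "(\<lambda>R. R \<inter> insert t (X - T) \<times> K) ` ?C \<subseteq> ?L"
      by (auto simp: lonesum_relations_def intro: lonesum_Int_Times)
    show "add_column r T t ` ?L \<subseteq> ?C"
    proof (rule image_subsetI)
      fix S assume "S \<in> ?L"
      then have S: "S \<subseteq> insert t (X - T) \<times> K" "lonesum S"
        unfolding lonesum_relations_def by blast+
      then have "add_column r T t S \<subseteq> X \<times> insert r K"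
        using T t unfolding add_column_def by blast
      moreover have "r \<notin> Range S" using S r by blast
      ultimately show "add_column r T t S \<in> ?C"
        using lonesum_add_column[OF S(2)] minimal_rows_add_column[OF _ t]
        by (simp add: lonesum_relations_def)
    qed
  qed
qed

text \<open>
  Classify the relations by their set \<open>T\<close> of smallest rows containing \<open>r\<close>; the class of the empty
  set consists of the relations that avoid \<open>r\<close>.
\<close>

lemma card_lonesum_relations_insert:
  assumes X: "finite X" and K: "finite K" and r: "r \<notin> K"
    and t: "\<And>T. T \<subseteq> X \<Longrightarrow> T \<noteq> {} \<Longrightarrow> t T \<in> T"
  shows "card (lonesum_relations X (insert r K))
       = card (lonesum_relations X K)
         + (\<Sum>T \<in> Pow X - {{}}. card (lonesum_relations (insert (t T) (X - T)) K))"
proof -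
  let ?L = "lonesum_relations X (insert r K)"
  let ?C = "\<lambda>T. {R \<in> ?L. minimal_rows r R = T}"
  have fin: "finite ?L" using X K by (simp add: finite_lonesum_relations)
  have empty: "?C {} = lonesum_relations X K"
  proof -
    have "R \<in> ?C {} \<longleftrightarrow> R \<in> lonesum_relations X K" for R
      using minimal_rows_eq_empty_iff[of "insert r K" R X r] K r
      unfolding lonesum_relations_def by blast
    then show ?thesis by blast
  qed
  have "minimal_rows r ` ?L \<subseteq> Pow X"
    unfolding lonesum_relations_def minimal_rows_def by blast
  then have "card ?L = (\<Sum>T \<in> Pow X. card (?C T))"
    using sum.group[of ?L "Pow X" "minimal_rows r" "\<lambda>_. 1 :: nat"] fin X by simp
  also have "\<dots> = card (?C {}) + (\<Sum>T \<in> Pow X - {{}}. card (?C T))"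
    by (rule sum.remove) (use X in auto)
  also have "(\<Sum>T \<in> Pow X - {{}}. card (?C T))
      = (\<Sum>T \<in> Pow X - {{}}. card (lonesum_relations (insert (t T) (X - T)) K))"
    using t r by (intro sum.cong refl card_lonesum_relations_minimal_rows) auto
  finally show ?thesis unfolding empty .
qed

lemma sum_nonempty_subsets_by_card:
  fixes f :: "nat \<Rightarrow> 'b :: comm_semiring_1"
  assumes "finite X"
  shows "(\<Sum>T \<in> Pow X - {{}}. f (card T)) = (\<Sum>i = 1..card X. of_nat (card X choose i) * f i)"
proof -
  have "card ` (Pow X - {{}}) \<subseteq> {1..card X}"
  proof (rule image_subsetI)
    fix T assume "T \<in> Pow X - {{}}"
    then have "finite T" "T \<noteq> {}" "T \<subseteq> X" using assms finite_subset by auto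
    then show "card T \<in> {1..card X}"
      using assms by (simp add: card_mono Suc_le_eq card_gt_0_iff)
  qed
  then have "(\<Sum>T \<in> Pow X - {{}}. f (card T))
      = (\<Sum>i = 1..card X. \<Sum>T \<in> {T \<in> Pow X - {{}}. card T = i}. f (card T))"
    using assms by (intro sum.group[symmetric]) auto
  also have "\<dots> = (\<Sum>i = 1..card X. of_nat (card X choose i) * f i)"
  proof (rule sum.cong)
    fix i assume "i \<in> {1..card X}"
    then have "{T \<in> Pow X - {{}}. card T = i} = {T. T \<subseteq> X \<and> card T = i}" by auto
    then show "(\<Sum>T \<in> {T \<in> Pow X - {{}}. card T = i}. f (card T)) = of_nat (card X choose i) * f i"
      using n_subsets[OF assms, of i] by simp
  qed simp
  finally show ?thesis .
qed

text \<open>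
  Merging rows changes the number of rows, so the induction on the number of columns needs its
  hypothesis for all row sets.
\<close>

theorem card_lonesum_relations:
  fixes X :: "'a set" and K :: "'b set"
  assumes "finite K" and "finite X"
  shows "of_nat (card (lonesum_relations X K)) = poly_bernoulli (- int (card K)) (card X)"
  using assms
proof (induction K arbitrary: X rule: finite_induct)
  case empty
  have "lonesum_relations X ({} :: 'b set) = {{}}"
    unfolding lonesum_relations_def lonesum_def by auto
  then show ?case by (simp add: poly_bernoulli_0)
next
  case (insert r K)
  define t where "t T = (SOME x. x \<in> T)" for T :: "'a set"
  have t: "t T \<in> T" if "T \<noteq> {}" for T
    using that unfolding t_def by (simp add: some_in_eq)
  let ?b = "poly_bernoulli (- int (card K))"
  have merged: "of_nat (card (lonesum_relations (insert (t T) (X - T)) K)) = ?b (Suc (card X - card T))"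
    if "T \<in> Pow X - {{}}" for T
  proof -
    have "card (insert (t T) (X - T)) = Suc (card X - card T)"
      using that t[of T] insert.prems finite_subset[of T X] by (simp add: card_Diff_subset)
    then show ?thesis using insert.IH[of "insert (t T) (X - T)"] insert.prems by simp
  qed
  have "of_nat (card (lonesum_relations X (insert r K)))
      = of_nat (card (lonesum_relations X K))
        + (\<Sum>T \<in> Pow X - {{}}. of_nat (card (lonesum_relations (insert (t T) (X - T)) K)) :: rat)"
    using card_lonesum_relations_insert[of X K r t] insert t by simp
  also have "\<dots> = ?b (card X) + (\<Sum>T \<in> Pow X - {{}}. ?b (Suc (card X - card T)))"
    using insert merged by simp
  also have "(\<Sum>T \<in> Pow X - {{}}. ?b (Suc (card X - card T)))
      = (\<Sum>i = 1..card X. of_nat (card X choose i) * ?b (Suc (card X - i)))"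
    using sum_nonempty_subsets_by_card[OF insert.prems, of "\<lambda>i. ?b (Suc (card X - i))"] .
  also have "?b (card X) + \<dots> = poly_bernoulli (- int (Suc (card K))) (card X)"
    by (rule poly_bernoulli_Suc[symmetric])
  finally show ?case using insert.hyps by simp
qed

section \<open>Acyclic orientations of complete bipartite graphs\<close>

definition orient :: "nat \<Rightarrow> nat \<Rightarrow> (nat \<times> nat) set \<Rightarrow> ((nat + nat) \<times> (nat + nat)) set" where
  "orient m n R = {(Inl i, Inr j) | i j. (i, j) \<in> R}
     \<union> {(Inr j, Inl i) | i j. i < m \<and> j < n \<and> (i, j) \<notin> R}"

lemma orient_iffs [simp]:
  "(Inl i, Inr j) \<in> orient m n R \<longleftrightarrow> (i, j) \<in> R"
  "(Inr j, Inl i) \<in> orient m n R \<longleftrightarrow> i < m \<and> j < n \<and> (i, j) \<notin> R"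
  "(Inl i, Inl i') \<notin> orient m n R"
  "(Inr j, Inr j') \<notin> orient m n R"
  by (auto simp: orient_def)

lemma orientation_orient:
  assumes "R \<subseteq> {..<m} \<times> {..<n}"
  shows "orientation (complete_bipartite m n) (orient m n R)"
proof -
  have "inj_on (\<lambda>(u, v). {u, v}) (orient m n R)"
  proof (rule inj_onI, clarsimp)
    fix u v u' v'
    assume "(u, v) \<in> orient m n R" "(u', v') \<in> orient m n R" "{u, v} = {u', v'}"
    then show "u = u' \<and> v = v'"
      by (cases u; cases v; cases u'; cases v') (simp_all add: doubleton_eq_iff)
  qed
  moreover have "(\<lambda>(u, v). {u, v}) ` orient m n R = edges (complete_bipartite m n)"
  proof
    show "(\<lambda>(u, v). {u, v}) ` orient m n R \<subseteq> edges (complete_bipartite m n)"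
      using assms by (auto simp: orient_def complete_bipartite_def)
    show "edges (complete_bipartite m n) \<subseteq> (\<lambda>(u, v). {u, v}) ` orient m n R"
    proof
      fix e assume "e \<in> edges (complete_bipartite m n)"
      then obtain i j where e: "e = {Inl i, Inr j}" "i < m" "j < n"
        by (auto simp: complete_bipartite_def)
      show "e \<in> (\<lambda>(u, v). {u, v}) ` orient m n R"
      proof (cases "(i, j) \<in> R")
        case True
        then show ?thesis using e by (intro image_eqI[of _ _ "(Inl i, Inr j)"]) auto
      next
        case False
        then show ?thesis using e by (intro image_eqI[of _ _ "(Inr j, Inl i)"]) auto
      qed
    qed
  qed
  ultimately show ?thesis unfolding orientation_def bij_betw_def by blast
qed

lemma orientation_complete_bipartiteE:
  assumes "orientation (complete_bipartite m n) D"
  obtains R where "R \<subseteq> {..<m} \<times> {..<n}" and "D = orient m n R"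
proof
  let ?R = "{(i, j). (Inl i, Inr j) \<in> D}"
  have inj: "inj_on (\<lambda>(u, v). {u, v}) D"
    and img: "(\<lambda>(u, v). {u, v}) ` D = {{Inl i, Inr j} | i j. i < m \<and> j < n}"
    using assms unfolding orientation_def bij_betw_def complete_bipartite_def by auto
  have arc: "\<exists>i j. i < m \<and> j < n \<and> {u, v} = {Inl i, Inr j}" if "(u, v) \<in> D" for u v
  proof -
    have "{u, v} \<in> (\<lambda>(u, v). {u, v}) ` D" using that by force
    then show ?thesis unfolding img by blast
  qed
  show sub: "?R \<subseteq> {..<m} \<times> {..<n}"
    using arc by (fastforce simp: doubleton_eq_iff)
  have one: "(Inr j, Inl i) \<in> D \<longleftrightarrow> (Inl i, Inr j) \<notin> D" if "i < m" "j < n" for i j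
  proof
    assume "(Inr j, Inl i) \<in> D"
    then show "(Inl i, Inr j) \<notin> D"
      using inj_onD[OF inj, of "(Inr j, Inl i)" "(Inl i, Inr j)"] by (auto simp: insert_commute)
  next
    have "{Inl i, Inr j} \<in> (\<lambda>(u, v). {u, v}) ` D" using img that by blast
    then show "(Inr j, Inl i) \<in> D" if "(Inl i, Inr j) \<notin> D"
      using that by (auto simp: doubleton_eq_iff)
  qed
  show "D = orient m n ?R"
  proof (rule set_eqI, rule iffI)
    fix p assume p: "p \<in> D"
    obtain u v where uv: "p = (u, v)" by fastforce
    with arc p obtain i j where "i < m" "j < n" "{u, v} = {Inl i, Inr j}" by blast
    then show "p \<in> orient m n ?R"
      using p uv one[of i j] by (auto simp: doubleton_eq_iff)
  next
    fix p assume "p \<in> orient m n ?R"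
    then show "p \<in> D" using one unfolding orient_def by auto
  qed
qed

lemma inj_orient: "inj (orient m n)"
proof (rule injI)
  fix R S assume "orient m n R = orient m n S"
  then have "(i, j) \<in> R \<longleftrightarrow> (i, j) \<in> S" for i j
    by (metis orient_iffs(1))
  then show "R = S" by auto
qed

lemma acyclic_if_decreasing:
  fixes h :: "'a \<Rightarrow> nat"
  assumes "\<And>u v. (u, v) \<in> D \<Longrightarrow> h v < h u"
  shows "acyclic D"
proof (rule acyclicI, intro allI notI)
  fix u assume "(u, u) \<in> D\<^sup>+"
  moreover have "h w < h v" if "(v, w) \<in> D\<^sup>+" for v w
    using that by (induction rule: trancl_induct) (use assms in \<open>auto intro: less_trans\<close>)
  ultimately show False by blast
qed

lemma acyclic_orient_iff_lonesum:
  assumes R: "R \<subseteq> {..<m} \<times> {..<n}"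
  shows "acyclic (orient m n R) \<longleftrightarrow> lonesum R"
proof
  let ?D = "orient m n R"
  assume acyc: "acyclic ?D"
  show "lonesum R"
    unfolding lonesum_iff_no_permutation
  proof (intro allI impI, rule ccontr)
    fix x y a b
    assume "(x, a) \<in> R" "(y, b) \<in> R" "\<not> ((x, b) \<in> R \<or> (y, a) \<in> R)"
    then have "(Inl x, Inr a) \<in> ?D" "(Inr a, Inl y) \<in> ?D" "(Inl y, Inr b) \<in> ?D" "(Inr b, Inl x) \<in> ?D"
      using R by auto
    then have "(Inl x, Inl x) \<in> ?D\<^sup>+" by (meson r_into_trancl' trancl_into_trancl)
    then show False using acyc unfolding acyclic_def by blast
  qed
next
  let ?D = "orient m n R"
  assume chain: "lonesum R"
  have fin: "finite (R `` {i})" for i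
    by (rule finite_subset[of _ "{..<n}"]) (use R in auto)
  \<comment> \<open>A right vertex sits just below the smallest out-neighbourhood that contains it; the
    value \<open>n + 1\<close>, above all cardinalities of rows, places the sources among them on top.\<close>
  define lvl where "lvl j = Min (insert (n + 1) {card (R `` {i}) | i. (i, j) \<in> R})" for j
  have finR: "finite {card (R `` {i}) | i. (i, j) \<in> R}" for j
  proof (rule finite_subset[of _ "(\<lambda>i. card (R `` {i})) ` {..<m}"])
    show "{card (R `` {i}) | i. (i, j) \<in> R} \<subseteq> (\<lambda>i. card (R `` {i})) ` {..<m}"
      using R by auto
  qed simp
  define h where "h = case_sum (\<lambda>i. 2 * card (R `` {i}) + 1) (\<lambda>j. 2 * lvl j)"
  show "acyclic ?D"
  proof (rule acyclic_if_decreasing[of _ h])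
    fix u v assume "(u, v) \<in> ?D"
    then consider (right) i j where "u = Inl i" "v = Inr j" "(i, j) \<in> R"
      | (left) i j where "u = Inr j" "v = Inl i" "i < m" "j < n" "(i, j) \<notin> R"
      by (auto simp: orient_def)
    then show "h v < h u"
    proof cases
      case right
      have "lvl j \<le> card (R `` {i})"
        unfolding lvl_def using finR[of j] right by (intro Min_le) auto
      then show ?thesis using right by (simp add: h_def)
    next
      case left
      have "card (R `` {i}) < card (R `` {i'})" if "(i', j) \<in> R" for i'
      proof (rule psubset_card_mono[OF fin])
        have "R `` {i} \<subseteq> R `` {i'} \<or> R `` {i'} \<subseteq> R `` {i}"
          using chain unfolding lonesum_def by blast
        then show "R `` {i} \<subset> R `` {i'}" using that left by blast
      qed
      moreover have "card (R `` {i}) \<le> n"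
        using card_mono[of "{..<n}" "R `` {i}"] R by auto
      ultimately have "card (R `` {i}) < lvl j"
        unfolding lvl_def using finR[of j] by (subst Min_gr_iff) auto
      then show ?thesis using left by (simp add: h_def)
    qed
  qed
qed

theorem num_acyclic_orientations_complete_bipartite:
  "num_acyclic_orientations (complete_bipartite m n) = card (lonesum_relations {..<m} {..<n})"
proof -
  have "acyclic_orientations (complete_bipartite m n) = orient m n ` lonesum_relations {..<m} {..<n}"
  proof
    show "acyclic_orientations (complete_bipartite m n) \<subseteq> orient m n ` lonesum_relations {..<m} {..<n}"
    proof
      fix D assume "D \<in> acyclic_orientations (complete_bipartite m n)"
      then have D: "orientation (complete_bipartite m n) D" "acyclic D"
        unfolding acyclic_orientations_def by blast+
      obtain R where R: "R \<subseteq> {..<m} \<times> {..<n}" "D = orient m n R"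
        using orientation_complete_bipartiteE[OF D(1)] .
      then show "D \<in> orient m n ` lonesum_relations {..<m} {..<n}"
        using D(2) acyclic_orient_iff_lonesum[OF R(1)] unfolding lonesum_relations_def by blast
    qed
    show "orient m n ` lonesum_relations {..<m} {..<n} \<subseteq> acyclic_orientations (complete_bipartite m n)"
      using orientation_orient acyclic_orient_iff_lonesum
      unfolding lonesum_relations_def acyclic_orientations_def by blast
  qed
  then show ?thesis
    unfolding num_acyclic_orientations_def
    by (simp add: card_image inj_on_subset[OF inj_orient])
qed

theorem theorem3p3:
  fixes n1 n2 :: nat
  assumes "n1 \<ge> 1" and "n2 \<ge> 1"
  shows "of_nat (num_acyclic_orientations (complete_bipartite n1 n2)) = poly_bernoulli (- int n2) n1
       \<and> poly_bernoulli (- int n2) n1 = poly_bernoulli (- int n1) n2"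
proof -
  have count: "of_nat (card (lonesum_relations {..<m} {..<n})) = poly_bernoulli (- int n) m" for m n :: nat
    using card_lonesum_relations[of "{..<n}" "{..<m}"] by simp
  have "poly_bernoulli (- int n2) n1 = poly_bernoulli (- int n1) n2"
    using count[of n1 n2] count[of n2 n1]
      card_lonesum_relations_commute[of "{..<n1}" "{..<n2}"] by simp
  then show ?thesis
    using count[of n1 n2] by (simp add: num_acyclic_orientations_complete_bipartite)
qed

end
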